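(* Let $\mathbf{G}$ be a finite set of generalized path conditions and let $\sigma$ be a sequent. If $\sigma$ is valid over the class of $\mathbf{G}$-frames, then $\mathrm{NCL}_{\mathbf{G}}\vdash\sigma$ (i.e. $\sigma$ has a proof in the labelled sequent calculus $\mathrm{NCL}_{\mathbf{G}}$).
   Context: **Formulae and semantics.** Formulae are generated by $\varphi ::= \bot \mid p \mid (\varphi\to\varphi)\mid \triangle\varphi$, with $p$ in a countably infinite set $\mathsf{Prop}$ ($\triangle$ is the non-contingency operator). A frame is a pair $(W,R)$ with $W\neq\emptyset$ and $R\subseteq W\times W$. A model is $\mathcal{M}=(W,R,V)$ with $(W,R)$ a frame and $V:W\to 2^{\mathsf{Prop}}$. Truth $\mathcal{M},w\models\varphi$ is standard for $\bot$, atoms ($\mathcal{M},w\models p$ iff $p\in V(w)$) and $\to$; and $\mathcal{M},w\models\triangle\varphi$ iff either $\mathcal{M},v\models\varphi$ for all $v$ with $wRv$, or $\mathcal{M},v\not\models\varphi$ for all $v$ with $wRv$. **Words and generalized path conditions (GPCs).** Let $\Sigma=\{x,\overline{x}\}$ and let $\Sigma^*$ be the set of finite words over $\Sigma$, with empty word $\epsilon$. Converse: $\epsilon^{-1}=\epsilon$, $x^{-1}=\overline{x}$, $\overline{x}^{-1}=x$, $(z_1\cdots z_n)^{-1}=z_n^{-1}\cdots z_1^{-1}$. For a set $X$ (possibly empty) and $Q\subseteq X\times X$: $Q_\epsilon=\{(a,a)\mid a\in X\}$, $Q_x=Q$, $Q_{\overline{x}}=Q^{-1}$, and $(a,b)\in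 Q_{z_1\cdots z_n}$ iff there are $a=a_0,\dots,a_n=b$ in $X$ with $(a_{i-1},a_i)\in Q_{z_i}$ for all $1\le i\le n$. A $\Sigma$-system $\mathcal{S}$ is a set of productions $z\mapsto\beta$ with $z\in\Sigma$, $\beta\in\Sigma^*$; $\rho z\tau\mapsto_{\mathcal{S}}\rho\eta\tau$ whenever $z\mapsto\eta\in\mathcal{S}$ and $\rho,\tau\in\Sigma^*$; $\mapsto_{\mathcal{S}}^*$ is the reflexive transitive closure; $\mathcal{L}_{\mathcal{S}}(\beta)=\{\gamma\mid\beta\mapsto^*_{\mathcal{S}}\gamma\}$. For $\alpha\in\Sigma^*$, $\mathcal{S}_\alpha=\{x\mapsto\alpha,\ \overline{x}\mapsto\alpha^{-1}\}$. A frame $(W,R)$ satisfies the GPC $\mathbf{G}(\alpha)$ if $R_\beta\subseteq R$ for every $\beta\in\mathcal{L}_{\mathcal{S}_\alpha}(x)$. For a finite set $\mathbf{G}$ of GPCs, a $\mathbf{G}$-frame is a frame satisfying every member of $\mathbf{G}$, and $\mathcal{S}(\mathbf{G})=\bigcup_{\mathbf{G}(\alpha)\in\mathbf{G}}\mathcal{S}_\alpha$. **Sequents.** Let $\mathsf{Var}$ be a countably infinite set of variables (labels). A relational atom is an expression $\mathsf{x}\,\mathsf{R}\,\mathsf{y}$ and a labelled formula is an expression $\mathsf{x}:\varphi$, with $\mathsf{x},\mathsf{y}\in\mathsf{Var}$ and $\varphi$ a formula. A sequent $\sigma=\Omega\dashv\Gamma\Rightarrow\Delta$ consists of a finite set $\Omega$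 of relational atoms (the control) and finite sets $\Gamma,\Delta$ of labelled formulae. $\mathsf{Var}(\sigma)$ is the set of variables occurring in $\sigma$. For a model $\mathcal{M}=(W,R,V)$ and an assignment $\lambda:\mathsf{Var}\to W$: $\mathcal{M},\lambda\Vdash\mathsf{x}\,\mathsf{R}\,\mathsf{y}$ iff $\lambda(\mathsf{x})R\lambda(\mathsf{y})$; $\mathcal{M},\lambda\Vdash\mathsf{x}:\varphi$ iff $\mathcal{M},\lambda(\mathsf{x})\models\varphi$; and $\mathcal{M},\lambda\Vdash\sigma$ iff, whenever all members of $\Omega$ and all members of $\Gamma$ hold under $\mathcal{M},\lambda$, some member of $\Delta$ holds under $\mathcal{M},\lambda$. $\sigma$ is valid over a class of frames if $\mathcal{M},\lambda\Vdash\sigma$ for every model $\mathcal{M}$ based on a frame in the class and every assignment $\lambda$. **Closure of controls.** For $\sigma=\Omega\dashv\Gamma\Rightarrow\Delta$ put $X=\mathsf{Var}(\sigma)$ and $Q=\{(\mathsf{x},\mathsf{y})\mid \mathsf{x}\,\mathsf{R}\,\mathsf{y}\in\Omega\}\subseteq X\times X$. Then $\mathcal{S}(\mathbf{G})(\Omega)$ is the set of relational atoms $\mathsf{x}\,\mathsf{R}\,\mathsf{y}$ with $(\mathsf{x},\mathsf{y})\in\bigcup_{\beta\in\mathcal{L}_{\mathcal{S}(\mathbf{G})}(x)}Q_\beta$ (computed over the domain $X$). **The calculus $\mathrm{NCL}_{\mathbf{G}}$.** Commas denote set union. Initial sequents: $\Omega\dashv\Gamma,\mathsf{x}:\bot\Rightarrow\Delta$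 and $\Omega\dashv\Gamma,\mathsf{x}:\varphi\Rightarrow\mathsf{x}:\varphi,\Delta$. Rules (premises / conclusion): - ${\to}\mathsf{L}$: from $\Omega\dashv\Gamma\Rightarrow\mathsf{x}:\varphi,\Delta$ and $\Omega\dashv\Gamma,\mathsf{x}:\psi\Rightarrow\Delta$ infer $\Omega\dashv\Gamma,\mathsf{x}:\varphi\to\psi\Rightarrow\Delta$. - ${\to}\mathsf{R}$: from $\Omega\dashv\Gamma,\mathsf{x}:\varphi\Rightarrow\mathsf{x}:\psi,\Delta$ infer $\Omega\dashv\Gamma\Rightarrow\mathsf{x}:\varphi\to\psi,\Delta$. - $\triangle\mathsf{L}$: from $\Omega\dashv\Gamma,\mathsf{x}:\triangle\varphi,\{\mathsf{y}:\varphi\mid\mathsf{x}\,\mathsf{R}\,\mathsf{y}\in\Omega\}\Rightarrow\Delta$ and $\Omega\dashv\Gamma,\mathsf{x}:\triangle\varphi\Rightarrow\{\mathsf{y}:\varphi\mid\mathsf{x}\,\mathsf{R}\,\mathsf{y}\in\Omega\},\Delta$ infer $\Omega\dashv\Gamma,\mathsf{x}:\triangle\varphi\Rightarrow\Delta$. - $\triangle\mathsf{R}$: from $\Omega,\mathsf{x}\,\mathsf{R}\,\mathsf{y},\mathsf{x}\,\mathsf{R}\,\mathsf{z}\dashv\Gamma,\mathsf{y}:\varphi\Rightarrow\mathsf{z}:\varphi,\mathsf{x}:\triangle\varphi,\Delta$ infer $\Omega\dashv\Gamma\Rightarrow\mathsf{x}:\triangle\varphi,\Delta$, provided $\mathsf{y}\neq\mathsf{z}$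 and neither $\mathsf{y}$ nor $\mathsf{z}$ occurs in the conclusion. - $\mathsf{r}_{\mathbf{G}}$: from $\mathcal{S}(\mathbf{G})(\Omega)\dashv\Gamma\Rightarrow\Delta$ infer $\Omega\dashv\Gamma\Rightarrow\Delta$ (closure computed over the variables of the conclusion). A proof of $\sigma$ in $\mathrm{NCL}_{\mathbf{G}}$ is a finite tree labelled by sequents according to the rules, with root labelled $\sigma$ and every leaf labelled by an initial sequent. *)

theory Defs
  imports Main
begin

type_synonym atom = nat
type_synonym var = nat

datatype fm =
    Bot ("\<bottom>")
  | Atom atom
  | Imp fm fm (infixr "\<^bold>\<rightarrow>" 55)
  | NonCont fm ("\<triangle> _" [70] 70)

type_synonym 'w frame = "'w set \<times> ('w \<times> 'w) set"

definition is_frame :: "'w frame \<Rightarrow> bool" where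
  "is_frame F \<longleftrightarrow> (case F of (W, R) \<Rightarrow> W \<noteq> {} \<and> R \<subseteq> W \<times> W)"

text \<open>The carrier \<open>W\<close> is not an argument of \<open>truth\<close>: in a frame all successors lie in \<open>W\<close>.\<close>

primrec truth :: "('w \<times> 'w) set \<Rightarrow> ('w \<Rightarrow> atom set) \<Rightarrow> 'w \<Rightarrow> fm \<Rightarrow> bool" where
  "truth R V w \<bottom> \<longleftrightarrow> False"
| "truth R V w (Atom p) \<longleftrightarrow> p \<in> V w"
| "truth R V w (\<phi> \<^bold>\<rightarrow> \<psi>) \<longleftrightarrow> (truth R V w \<phi> \<longrightarrow> truth R V w \<psi>)"
| "truth R V w (\<triangle> \<phi>) \<longleftrightarrow>
     (\<forall>v. (w, v) \<in> R \<longrightarrow> truth R V v \<phi>) \<or> (\<forall>v. (w, v) \<in> R \<longrightarrow> \<not> truth R V v \<phi>)"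

datatype letter = Fwd | Bwd

type_synonym word = "letter list"

primrec letter_conv :: "letter \<Rightarrow> letter" where
  "letter_conv Fwd = Bwd"
| "letter_conv Bwd = Fwd"

definition word_conv :: "word \<Rightarrow> word" where
  "word_conv \<beta> = rev (map letter_conv \<beta>)"

primrec letter_rel :: "('a \<times> 'a) set \<Rightarrow> letter \<Rightarrow> ('a \<times> 'a) set" where
  "letter_rel Q Fwd = Q"
| "letter_rel Q Bwd = Q\<inverse>"

text \<open>\<open>word_rel X Q \<beta>\<close> is the relation \<open>Q\<^sub>\<beta>\<close> over the domain \<open>X\<close>; for the empty word the
  condition reduces to \<open>a = b\<close> with \<open>a \<in> X\<close>, and for one letter (with \<open>Q \<subseteq> X \<times> X\<close>)
  to \<open>(a, b) \<in> letter_rel Q z\<close>.\<close>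

definition word_rel :: "'a set \<Rightarrow> ('a \<times> 'a) set \<Rightarrow> word \<Rightarrow> ('a \<times> 'a) set" where
  "word_rel X Q \<beta> = {(a, b). \<exists>s :: nat \<Rightarrow> 'a. s 0 = a \<and> s (length \<beta>) = b \<and>
      (\<forall>i\<le>length \<beta>. s i \<in> X) \<and>
      (\<forall>i<length \<beta>. (s i, s (Suc i)) \<in> letter_rel Q (\<beta> ! i))}"

type_synonym system = "(letter \<times> word) set"

definition sys_step :: "system \<Rightarrow> (word \<times> word) set" where
  "sys_step S = {(\<rho> @ [z] @ \<tau>, \<rho> @ \<eta> @ \<tau>) | \<rho> z \<eta> \<tau>. (z, \<eta>) \<in> S}"

definition lang :: "system \<Rightarrow> word \<Rightarrow> word set" where
  "lang S \<beta> = {\<gamma>. (\<beta>, \<gamma>) \<in> (sys_step S)\<^sup>*}"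

definition path_system :: "word \<Rightarrow> system" where
  "path_system \<alpha> = {(Fwd, \<alpha>), (Bwd, word_conv \<alpha>)}"

datatype gpc = GPC word

primrec gpc_system :: "gpc \<Rightarrow> system" where
  "gpc_system (GPC \<alpha>) = path_system \<alpha>"

definition satisfies_gpc :: "'w frame \<Rightarrow> gpc \<Rightarrow> bool" where
  "satisfies_gpc F g \<longleftrightarrow>
     (case F of (W, R) \<Rightarrow> \<forall>\<beta>\<in>lang (gpc_system g) [Fwd]. word_rel W R \<beta> \<subseteq> R)"

definition gpc_frames :: "gpc set \<Rightarrow> 'w frame set" where
  "gpc_frames G = {F. is_frame F \<and> (\<forall>g\<in>G. satisfies_gpc F g)}"

definition system_of :: "gpc set \<Rightarrow> system" where
  "system_of G = (\<Union>g\<in>G. gpc_system g)"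

datatype ratom = Rel var var
datatype lform = Lab var fm

datatype sequent =
  Sequent "ratom set" "lform set" "lform set" ("_ \<stileturn> _ \<Rrightarrow> _" [51, 51, 51] 50)

primrec finite_sequent :: "sequent \<Rightarrow> bool" where
  "finite_sequent (\<Omega> \<stileturn> \<Gamma> \<Rrightarrow> \<Delta>) \<longleftrightarrow> finite \<Omega> \<and> finite \<Gamma> \<and> finite \<Delta>"

primrec vars :: "sequent \<Rightarrow> var set" where
  "vars (\<Omega> \<stileturn> \<Gamma> \<Rrightarrow> \<Delta>) =
     (\<Union>r\<in>\<Omega>. case r of Rel x y \<Rightarrow> {x, y}) \<union> (\<Union>l\<in>\<Gamma> \<union> \<Delta>. case l of Lab x \<phi> \<Rightarrow> {x})"

primrec holds_ratom :: "('w \<times> 'w) set \<Rightarrow> (var \<Rightarrow> 'w) \<Rightarrow> ratom \<Rightarrow> bool" where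
  "holds_ratom R l (Rel x y) \<longleftrightarrow> (l x, l y) \<in> R"

primrec holds_lform ::
  "('w \<times> 'w) set \<Rightarrow> ('w \<Rightarrow> atom set) \<Rightarrow> (var \<Rightarrow> 'w) \<Rightarrow> lform \<Rightarrow> bool" where
  "holds_lform R V l (Lab x \<phi>) \<longleftrightarrow> truth R V (l x) \<phi>"

primrec holds_sequent ::
  "('w \<times> 'w) set \<Rightarrow> ('w \<Rightarrow> atom set) \<Rightarrow> (var \<Rightarrow> 'w) \<Rightarrow> sequent \<Rightarrow> bool" where
  "holds_sequent R V l (\<Omega> \<stileturn> \<Gamma> \<Rrightarrow> \<Delta>) \<longleftrightarrow>
     ((\<forall>r\<in>\<Omega>. holds_ratom R l r) \<and> (\<forall>\<gamma>\<in>\<Gamma>. holds_lform R V l \<gamma>) \<longrightarrow>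
      (\<exists>\<delta>\<in>\<Delta>. holds_lform R V l \<delta>))"

text \<open>All worlds of the frames in \<open>C\<close> come from one type \<open>'w\<close>. For infinite \<open>'w\<close> the frames over
  subsets of \<open>'w\<close> include an isomorphic copy of every countable frame.\<close>

definition valid_over :: "'w frame set \<Rightarrow> sequent \<Rightarrow> bool" where
  "valid_over C \<sigma> \<longleftrightarrow>
     (\<forall>(W, R)\<in>C. \<forall>V l. range l \<subseteq> W \<longrightarrow> holds_sequent R V l \<sigma>)"

definition control_closure :: "gpc set \<Rightarrow> var set \<Rightarrow> ratom set \<Rightarrow> ratom set" where
  "control_closure G X \<Omega> =
     {Rel x y | x y. (x, y) \<in> (\<Union>\<beta>\<in>lang (system_of G) [Fwd]. word_rel X {(u, v). Rel u v \<in> \<Omega>} \<beta>)}"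

text \<open>Since the initial sequents are required to be finite, every derivable sequent is finite.\<close>

inductive NCL :: "gpc set \<Rightarrow> sequent \<Rightarrow> bool" (infix "\<turnstile>" 45) for G where
  init_Bot: "finite_sequent (\<Omega> \<stileturn> \<Gamma> \<union> {Lab x \<bottom>} \<Rrightarrow> \<Delta>) \<Longrightarrow>
    G \<turnstile> \<Omega> \<stileturn> \<Gamma> \<union> {Lab x \<bottom>} \<Rrightarrow> \<Delta>"
| init_Id: "finite_sequent (\<Omega> \<stileturn> \<Gamma> \<union> {Lab x \<phi>} \<Rrightarrow> {Lab x \<phi>} \<union> \<Delta>) \<Longrightarrow>
    G \<turnstile> \<Omega> \<stileturn> \<Gamma> \<union> {Lab x \<phi>} \<Rrightarrow> {Lab x \<phi>} \<union> \<Delta>"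
| ImpL: "G \<turnstile> \<Omega> \<stileturn> \<Gamma> \<Rrightarrow> {Lab x \<phi>} \<union> \<Delta> \<Longrightarrow>
    G \<turnstile> \<Omega> \<stileturn> \<Gamma> \<union> {Lab x \<psi>} \<Rrightarrow> \<Delta> \<Longrightarrow>
    G \<turnstile> \<Omega> \<stileturn> \<Gamma> \<union> {Lab x (\<phi> \<^bold>\<rightarrow> \<psi>)} \<Rrightarrow> \<Delta>"
| ImpR: "G \<turnstile> \<Omega> \<stileturn> \<Gamma> \<union> {Lab x \<phi>} \<Rrightarrow> {Lab x \<psi>} \<union> \<Delta> \<Longrightarrow>
    G \<turnstile> \<Omega> \<stileturn> \<Gamma> \<Rrightarrow> {Lab x (\<phi> \<^bold>\<rightarrow> \<psi>)} \<union> \<Delta>"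
| NonContL: "G \<turnstile> \<Omega> \<stileturn> \<Gamma> \<union> {Lab x (\<triangle> \<phi>)} \<union> {Lab y \<phi> | y. Rel x y \<in> \<Omega>} \<Rrightarrow> \<Delta> \<Longrightarrow>
    G \<turnstile> \<Omega> \<stileturn> \<Gamma> \<union> {Lab x (\<triangle> \<phi>)} \<Rrightarrow> {Lab y \<phi> | y. Rel x y \<in> \<Omega>} \<union> \<Delta> \<Longrightarrow>
    G \<turnstile> \<Omega> \<stileturn> \<Gamma> \<union> {Lab x (\<triangle> \<phi>)} \<Rrightarrow> \<Delta>"
| NonContR: "G \<turnstile> \<Omega> \<union> {Rel x y, Rel x z} \<stileturn> \<Gamma> \<union> {Lab y \<phi>} \<Rrightarrow> {Lab z \<phi>, Lab x (\<triangle> \<phi>)} \<union> \<Delta> \<Longrightarrow>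
    y \<noteq> z \<Longrightarrow>
    y \<notin> vars (\<Omega> \<stileturn> \<Gamma> \<Rrightarrow> {Lab x (\<triangle> \<phi>)} \<union> \<Delta>) \<Longrightarrow>
    z \<notin> vars (\<Omega> \<stileturn> \<Gamma> \<Rrightarrow> {Lab x (\<triangle> \<phi>)} \<union> \<Delta>) \<Longrightarrow>
    G \<turnstile> \<Omega> \<stileturn> \<Gamma> \<Rrightarrow> {Lab x (\<triangle> \<phi>)} \<union> \<Delta>"
| Closure: "G \<turnstile> control_closure G (vars (\<Omega> \<stileturn> \<Gamma> \<Rrightarrow> \<Delta>)) \<Omega> \<stileturn> \<Gamma> \<Rrightarrow> \<Delta> \<Longrightarrow>
    G \<turnstile> \<Omega> \<stileturn> \<Gamma> \<Rrightarrow> \<Delta>"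

end

(* An unprovable sequent starts an increasing chain of unprovable finite sequents: each step closes
   the control and applies backwards the rule for one labelled formula, keeping an unprovable
   premise, and every labelled formula is treated infinitely often. The variables of the chain, with
   the union of its controls as accessibility relation, form a G-frame, because a path is finite and
   hence already present at some stage whose control is then closed. In the induced model all
   antecedents of the chain hold and all succedents fail. *)

theory Submission
  imports Defs Complex_Main "HOL-Library.Countable"
begin

section \<open>Countability of labelled formulae, components of sequents, saturation
  conditions\<close>

instance fm :: countable
  by countable_datatype

instance lform :: countable
  by countable_datatype

primrec control :: "sequent \<Rightarrow> ratom set" where
  "control (\<Omega> \<stileturn> \<Gamma> \<Rrightarrow> \<Delta>) = \<Omega>"

primrec antecedent :: "sequent \<Rightarrow> lform set" where
  "antecedent (\<Omega> \<stileturn> \<Gamma> \<Rrightarrow> \<Delta>) = \<Gamma>"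

primrec succedent :: "sequent \<Rightarrow> lform set" where
  "succedent (\<Omega> \<stileturn> \<Gamma> \<Rrightarrow> \<Delta>) = \<Delta>"

definition extends :: "sequent \<Rightarrow> sequent \<Rightarrow> bool" where
  "extends \<tau> \<sigma> \<longleftrightarrow> control \<sigma> \<subseteq> control \<tau> \<and> antecedent \<sigma> \<subseteq> antecedent \<tau> \<and> succedent \<sigma> \<subseteq> succedent \<tau>"

text \<open>The trace left by passing to one premise of the left rule. The control \<Omega> is a
  separate argument because the rule for \<open>\<triangle>\<close> reaches only the successors
  known when it is applied; those added later must wait for another treatment.\<close>

primrec left_analysed :: "ratom set \<Rightarrow> var \<Rightarrow> fm \<Rightarrow> sequent \<Rightarrow> bool" where
  "left_analysed \<Omega> x \<bottom> \<tau> \<longleftrightarrow> True"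
| "left_analysed \<Omega> x (Atom p) \<tau> \<longleftrightarrow> True"
| "left_analysed \<Omega> x (\<phi> \<^bold>\<rightarrow> \<psi>) \<tau> \<longleftrightarrow> Lab x \<phi> \<in> succedent \<tau> \<or> Lab x \<psi> \<in> antecedent \<tau>"
| "left_analysed \<Omega> x (\<triangle> \<phi>) \<tau> \<longleftrightarrow>
     {Lab y \<phi> | y. Rel x y \<in> \<Omega>} \<subseteq> antecedent \<tau> \<or> {Lab y \<phi> | y. Rel x y \<in> \<Omega>} \<subseteq> succedent \<tau>"

text \<open>No control argument is needed on the right: the rule for \<open>\<triangle>\<close>
  brings its own two witnesses, one for and one against the formula, so a single treatment
  suffices.\<close>

primrec right_analysed :: "var \<Rightarrow> fm \<Rightarrow> sequent \<Rightarrow> bool" where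
  "right_analysed x \<bottom> \<tau> \<longleftrightarrow> True"
| "right_analysed x (Atom p) \<tau> \<longleftrightarrow> True"
| "right_analysed x (\<phi> \<^bold>\<rightarrow> \<psi>) \<tau> \<longleftrightarrow> Lab x \<phi> \<in> antecedent \<tau> \<and> Lab x \<psi> \<in> succedent \<tau>"
| "right_analysed x (\<triangle> \<phi>) \<tau> \<longleftrightarrow>
     (\<exists>y z. {Rel x y, Rel x z} \<subseteq> control \<tau> \<and> Lab y \<phi> \<in> antecedent \<tau> \<and> Lab z \<phi> \<in> succedent \<tau>)"

section \<open>Variables and finiteness of sequents\<close>

lemma finite_vars: "finite_sequent \<sigma> \<Longrightarrow> finite (vars \<sigma>)"
  by (cases \<sigma>) (auto split: ratom.splits lform.splits)

lemma vars_mono: "extends \<tau> \<sigma> \<Longrightarrow> vars \<sigma> \<subseteq> vars \<tau>"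
  by (cases \<sigma>; cases \<tau>) (fastforce simp: extends_def)

lemma control_vars: "Rel x y \<in> control \<sigma> \<Longrightarrow> x \<in> vars \<sigma> \<and> y \<in> vars \<sigma>"
  by (cases \<sigma>) force

lemma antecedent_vars: "Lab x \<phi> \<in> antecedent \<sigma> \<Longrightarrow> x \<in> vars \<sigma>"
  by (cases \<sigma>) force

lemma succedent_vars: "Lab x \<phi> \<in> succedent \<sigma> \<Longrightarrow> x \<in> vars \<sigma>"
  by (cases \<sigma>) force

lemma finite_successors: "finite \<Omega> \<Longrightarrow> finite {Lab y \<phi> | y. Rel x y \<in> \<Omega>}"
proof -
  assume "finite \<Omega>"
  then have "finite ((\<lambda>r. case r of Rel u v \<Rightarrow> Lab v \<phi>) ` \<Omega>)"
    by simp
  then show ?thesis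
    by (rule rev_finite_subset) (force split: ratom.splits)
qed

section \<open>Path relations and the closure of controls\<close>

lemma word_rel_subset: "word_rel X Q \<beta> \<subseteq> X \<times> X"
  unfolding word_rel_def by auto

lemma word_rel_Fwd: "word_rel X Q [Fwd] = Q \<inter> X \<times> X"
proof
  show "Q \<inter> X \<times> X \<subseteq> word_rel X Q [Fwd]"
  proof clarify
    fix a b
    assume "(a, b) \<in> Q" "a \<in> X" "b \<in> X"
    then show "(a, b) \<in> word_rel X Q [Fwd]"
      unfolding word_rel_def by (auto intro!: exI[of _ "\<lambda>i. if i = 0 then a else b"])
  qed
qed (auto simp: word_rel_def)

lemma finite_control_closure: "finite X \<Longrightarrow> finite (control_closure G X \<Omega>)"
proof -
  assume "finite X"
  then have "finite ((\<lambda>(x, y). Rel x y) ` (X \<times> X))"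
    by simp
  then show ?thesis
    by (rule rev_finite_subset) (use word_rel_subset in \<open>force simp: control_closure_def\<close>)
qed

text \<open>The one-letter word \<open>[Fwd]\<close> is derived in zero steps, and its path relation
  is the control itself.\<close>

lemma control_subset_closure: "control \<sigma> \<subseteq> control_closure G (vars \<sigma>) (control \<sigma>)"
proof
  fix r
  assume r: "r \<in> control \<sigma>"
  obtain x y where xy: "r = Rel x y"
    by (cases r)
  have "(x, y) \<in> word_rel (vars \<sigma>) {(u, v). Rel u v \<in> control \<sigma>} [Fwd]"
    using r xy control_vars[of x y \<sigma>] by (simp add: word_rel_Fwd)
  moreover have "[Fwd] \<in> lang (system_of G) [Fwd]"
    by (simp add: lang_def)
  ultimately show "r \<in> control_closure G (vars \<sigma>) (control \<sigma>)"
    unfolding control_closure_def xy by blast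
qed

text \<open>Lets a word derived with the system of a single condition count as derived with the
  union \<open>system_of G\<close>, which the closure rule uses.\<close>

lemma lang_mono:
  assumes "S \<subseteq> T"
  shows "lang S \<beta> \<subseteq> lang T \<beta>"
proof -
  have "sys_step S \<subseteq> sys_step T"
    using assms unfolding sys_step_def by blast
  from rtrancl_mono[OF this] show ?thesis
    unfolding lang_def by blast
qed

section \<open>Unprovable sequents and the rules read backwards\<close>

lemma unprovable_disjoint:
  assumes "finite_sequent \<sigma>" and "\<not> G \<turnstile> \<sigma>" and "l \<in> antecedent \<sigma>" and "l \<in> succedent \<sigma>"
  shows False
proof -
  obtain \<Omega> \<Gamma> \<Delta> where \<sigma>: "\<sigma> = (\<Omega> \<stileturn> \<Gamma> \<Rrightarrow> \<Delta>)"
    by (cases \<sigma>)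
  obtain x \<phi> where l: "l = Lab x \<phi>"
    by (cases l)
  have "\<sigma> = (\<Omega> \<stileturn> \<Gamma> \<union> {Lab x \<phi>} \<Rrightarrow> {Lab x \<phi>} \<union> \<Delta>)"
    using assms \<sigma> l by auto
  then show False
    using init_Id assms(1,2) by metis
qed

lemma unprovable_no_Bot:
  assumes "finite_sequent \<sigma>" and "\<not> G \<turnstile> \<sigma>"
  shows "Lab x \<bottom> \<notin> antecedent \<sigma>"
proof
  assume bot: "Lab x \<bottom> \<in> antecedent \<sigma>"
  obtain \<Omega> \<Gamma> \<Delta> where \<sigma>: "\<sigma> = (\<Omega> \<stileturn> \<Gamma> \<Rrightarrow> \<Delta>)"
    by (cases \<sigma>)
  have "\<sigma> = (\<Omega> \<stileturn> \<Gamma> \<union> {Lab x \<bottom>} \<Rrightarrow> \<Delta>)"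
    using bot \<sigma> by auto
  then show False
    using init_Bot assms by metis
qed

text \<open>If all premises of a left rule were provable, so would be the conclusion; hence some
  premise is unprovable, and it serves as \<tau>.\<close>

lemma left_step:
  assumes fin: "finite_sequent \<sigma>" and unprov: "\<not> G \<turnstile> \<sigma>" and mem: "Lab x \<phi> \<in> antecedent \<sigma>"
  shows "\<exists>\<tau>. finite_sequent \<tau> \<and> \<not> G \<turnstile> \<tau> \<and> extends \<tau> \<sigma> \<and> left_analysed (control \<sigma>) x \<phi> \<tau>"
proof -
  obtain \<Omega> \<Gamma> \<Delta> where \<sigma>: "\<sigma> = (\<Omega> \<stileturn> \<Gamma> \<Rrightarrow> \<Delta>)"
    by (cases \<sigma>)
  \<comment> \<open>Commas are unions, so the principal formula may already lie in
    \<open>\<Gamma>\<close>. The premises then retain it and extend \<sigma>.\<close>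
  have eq: "\<sigma> = (\<Omega> \<stileturn> \<Gamma> \<union> {Lab x \<phi>} \<Rrightarrow> \<Delta>)"
    using mem \<sigma> by auto
  show ?thesis
  proof (cases \<phi>)
    case (Imp \<psi> \<chi>)
    have "\<not> G \<turnstile> \<Omega> \<stileturn> \<Gamma> \<Rrightarrow> {Lab x \<psi>} \<union> \<Delta> \<or> \<not> G \<turnstile> \<Omega> \<stileturn> \<Gamma> \<union> {Lab x \<chi>} \<Rrightarrow> \<Delta>"
      using ImpL unprov eq Imp by metis
    then show ?thesis
    proof
      assume "\<not> G \<turnstile> \<Omega> \<stileturn> \<Gamma> \<Rrightarrow> {Lab x \<psi>} \<union> \<Delta>"
      then show ?thesis
        using fin \<sigma> Imp by (intro exI[of _ "\<Omega> \<stileturn> \<Gamma> \<Rrightarrow> {Lab x \<psi>} \<union> \<Delta>"]) (auto simp: extends_def)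
    next
      assume "\<not> G \<turnstile> \<Omega> \<stileturn> \<Gamma> \<union> {Lab x \<chi>} \<Rrightarrow> \<Delta>"
      then show ?thesis
        using fin \<sigma> Imp by (intro exI[of _ "\<Omega> \<stileturn> \<Gamma> \<union> {Lab x \<chi>} \<Rrightarrow> \<Delta>"]) (auto simp: extends_def)
    qed
  next
    case (NonCont \<psi>)
    let ?N = "{Lab y \<psi> | y. Rel x y \<in> \<Omega>}"
    have finN: "finite ?N"
      using fin \<sigma> by (intro finite_successors) simp
    have "\<not> G \<turnstile> \<Omega> \<stileturn> \<Gamma> \<union> {Lab x (\<triangle> \<psi>)} \<union> ?N \<Rrightarrow> \<Delta> \<or>
        \<not> G \<turnstile> \<Omega> \<stileturn> \<Gamma> \<union> {Lab x (\<triangle> \<psi>)} \<Rrightarrow> ?N \<union> \<Delta>"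
      using NonContL[of G \<Omega> \<Gamma> x \<psi> \<Delta>] unprov eq NonCont by metis
    then show ?thesis
    proof
      assume "\<not> G \<turnstile> \<Omega> \<stileturn> \<Gamma> \<union> {Lab x (\<triangle> \<psi>)} \<union> ?N \<Rrightarrow> \<Delta>"
      then show ?thesis
        using fin finN \<sigma> NonCont
        by (intro exI[of _ "\<Omega> \<stileturn> \<Gamma> \<union> {Lab x (\<triangle> \<psi>)} \<union> ?N \<Rrightarrow> \<Delta>"]) (auto simp: extends_def)
    next
      assume "\<not> G \<turnstile> \<Omega> \<stileturn> \<Gamma> \<union> {Lab x (\<triangle> \<psi>)} \<Rrightarrow> ?N \<union> \<Delta>"
      then show ?thesis
        using fin finN \<sigma> NonCont
        by (intro exI[of _ "\<Omega> \<stileturn> \<Gamma> \<union> {Lab x (\<triangle> \<psi>)} \<Rrightarrow> ?N \<union> \<Delta>"]) (auto simp: extends_def)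
    qed
  \<comment> \<open>Falsum and atoms require no analysis, so \<sigma> itself is the witness.\<close>
  qed (use fin unprov in \<open>auto simp: extends_def\<close>)
qed

lemma right_step:
  assumes fin: "finite_sequent \<sigma>" and unprov: "\<not> G \<turnstile> \<sigma>" and mem: "Lab x \<phi> \<in> succedent \<sigma>"
  shows "\<exists>\<tau>. finite_sequent \<tau> \<and> \<not> G \<turnstile> \<tau> \<and> extends \<tau> \<sigma> \<and> right_analysed x \<phi> \<tau>"
proof -
  obtain \<Omega> \<Gamma> \<Delta> where \<sigma>: "\<sigma> = (\<Omega> \<stileturn> \<Gamma> \<Rrightarrow> \<Delta>)"
    by (cases \<sigma>)
  have eq: "\<sigma> = (\<Omega> \<stileturn> \<Gamma> \<Rrightarrow> {Lab x \<phi>} \<union> \<Delta>)"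
    using mem \<sigma> by auto
  show ?thesis
  proof (cases \<phi>)
    case (Imp \<psi> \<chi>)
    have "\<not> G \<turnstile> \<Omega> \<stileturn> \<Gamma> \<union> {Lab x \<psi>} \<Rrightarrow> {Lab x \<chi>} \<union> \<Delta>"
      using ImpR unprov eq Imp by metis
    then show ?thesis
      using fin \<sigma> Imp
      by (intro exI[of _ "\<Omega> \<stileturn> \<Gamma> \<union> {Lab x \<psi>} \<Rrightarrow> {Lab x \<chi>} \<union> \<Delta>"]) (auto simp: extends_def)
  next
    case (NonCont \<psi>)
    \<comment> \<open>Only finitely many variables occur in \<sigma>, so two distinct fresh ones
      exist, as the side conditions of \<open>NonContR\<close> demand.\<close>
    obtain y where y: "y \<notin> vars \<sigma>"
      using finite_vars[OF fin] ex_new_if_finite infinite_UNIV_nat by blast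
    obtain z where z: "z \<notin> insert y (vars \<sigma>)"
      using finite_vars[OF fin] ex_new_if_finite infinite_UNIV_nat finite_insert by metis
    let ?\<tau> = "\<Omega> \<union> {Rel x y, Rel x z} \<stileturn> \<Gamma> \<union> {Lab y \<psi>} \<Rrightarrow> {Lab z \<psi>, Lab x (\<triangle> \<psi>)} \<union> \<Delta>"
    have "\<not> G \<turnstile> ?\<tau>"
      using NonContR[of G \<Omega> x y z \<Gamma> \<psi> \<Delta>] y z unprov eq NonCont by auto
    then show ?thesis
      using fin \<sigma> NonCont by (intro exI[of _ ?\<tau>]) (auto simp: extends_def)
  qed (use fin unprov in \<open>auto simp: extends_def\<close>)
qed

section \<open>Saturation steps and the fair chain\<close>

definition saturation_step :: "gpc set \<Rightarrow> lform \<Rightarrow> sequent \<Rightarrow> sequent \<Rightarrow> bool" where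
  "saturation_step G l \<sigma> \<tau> \<longleftrightarrow> extends \<tau> \<sigma> \<and>
     control_closure G (vars \<sigma>) (control \<sigma>) \<subseteq> control \<tau> \<and>
     (\<forall>x \<phi>. l = Lab x \<phi> \<longrightarrow>
       (l \<in> antecedent \<sigma> \<longrightarrow> left_analysed (control \<sigma>) x \<phi> \<tau>) \<and>
       (l \<in> succedent \<sigma> \<longrightarrow> right_analysed x \<phi> \<tau>))"

text \<open>Needed because the rule is applied over the closed control, while
  \<open>saturation_step\<close> refers to the original one.\<close>

lemma left_analysed_antimono:
  "\<lbrakk>left_analysed \<Omega>' x \<phi> \<tau>; \<Omega> \<subseteq> \<Omega>'\<rbrakk> \<Longrightarrow> left_analysed \<Omega> x \<phi> \<tau>"
  by (cases \<phi>) auto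

text \<open>First \<open>Closure\<close> is read backwards, then the rule for \<open>l\<close> is
  applied to the result. The closed control stays finite since it relates only the finitely many
  variables of \<sigma>.\<close>

lemma saturation_step_exists:
  assumes fin: "finite_sequent \<sigma>" and unprov: "\<not> G \<turnstile> \<sigma>"
  shows "\<exists>\<tau>. finite_sequent \<tau> \<and> \<not> G \<turnstile> \<tau> \<and> saturation_step G l \<sigma> \<tau>"
proof -
  obtain \<Omega> \<Gamma> \<Delta> where \<sigma>: "\<sigma> = (\<Omega> \<stileturn> \<Gamma> \<Rrightarrow> \<Delta>)"
    by (cases \<sigma>)
  obtain x \<phi> where l: "l = Lab x \<phi>"
    by (cases l)
  let ?C = "control_closure G (vars \<sigma>) \<Omega>"
  let ?\<rho> = "?C \<stileturn> \<Gamma> \<Rrightarrow> \<Delta>"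
  have sub: "\<Omega> \<subseteq> ?C"
    using control_subset_closure[of \<sigma> G] \<sigma> by simp
  have unprov': "\<not> G \<turnstile> ?\<rho>"
    using Closure unprov \<sigma> by metis
  have fin': "finite_sequent ?\<rho>"
    using fin finite_control_closure[OF finite_vars[OF fin]] unfolding \<sigma> by simp
  \<comment> \<open>As \<open>l\<close> cannot stand on both sides, at most one of the two analysis
    clauses is active, and a single rule application meets it.\<close>
  have disj: "\<not> (l \<in> \<Gamma> \<and> l \<in> \<Delta>)"
    using unprovable_disjoint[OF fin unprov, of l] \<sigma> by auto
  consider "l \<in> \<Gamma>" | "l \<in> \<Delta>" | "l \<notin> \<Gamma>" "l \<notin> \<Delta>"
    by blast
  then show ?thesis
  proof cases
    case 1
    obtain \<tau> where "finite_sequent \<tau>" "\<not> G \<turnstile> \<tau>" "extends \<tau> ?\<rho>" "left_analysed ?C x \<phi> \<tau>"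
      using left_step[OF fin' unprov', of x \<phi>] 1 l by auto
    moreover from this have "left_analysed \<Omega> x \<phi> \<tau>"
      using left_analysed_antimono sub by blast
    ultimately show ?thesis
      using 1 disj l sub \<sigma> by (intro exI[of _ \<tau>]) (auto simp: saturation_step_def extends_def)
  next
    case 2
    obtain \<tau> where "finite_sequent \<tau>" "\<not> G \<turnstile> \<tau>" "extends \<tau> ?\<rho>" "right_analysed x \<phi> \<tau>"
      using right_step[OF fin' unprov', of x \<phi>] 2 l by auto
    then show ?thesis
      using 2 disj l sub \<sigma> by (intro exI[of _ \<tau>]) (auto simp: saturation_step_def extends_def)
  next
    case 3
    then show ?thesis
      using fin' unprov' sub \<sigma> l
      by (intro exI[of _ ?\<rho>]) (auto simp: saturation_step_def extends_def)
  qed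
qed

lemma saturated_chain_exists:
  assumes "finite_sequent \<sigma>" and "\<not> G \<turnstile> \<sigma>"
  shows "\<exists>c. c 0 = \<sigma> \<and> (\<forall>n. finite_sequent (c n) \<and> \<not> G \<turnstile> c n \<and>
    saturation_step G (t n) (c n) (c (Suc n)))"
proof -
  \<comment> \<open>Dependent choice; the conjunct guarded by \<open>n = 0\<close> fixes the
    starting sequent.\<close>
  have "\<exists>c. \<forall>n. (finite_sequent (c n) \<and> \<not> G \<turnstile> c n \<and> (n = 0 \<longrightarrow> c n = \<sigma>)) \<and>
      saturation_step G (t n) (c n) (c (Suc n))"
    by (rule dependent_nat_choice) (use assms saturation_step_exists in auto)
  then show ?thesis
    by metis
qed

text \<open>Read \<open>n\<close> as the code of a pair and enumerate by its first component. The
  code of a pair is at least its second component, so pairing \<open>a\<close> with \<open>m\<close>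
  gives an occurrence of \<open>a\<close> at or beyond \<open>m\<close>.\<close>

lemma fair_enumeration: "\<exists>t :: nat \<Rightarrow> 'a::countable. \<forall>a m. \<exists>n\<ge>m. t n = a"
proof (rule exI, intro allI)
  fix a :: 'a and m
  show "\<exists>n\<ge>m. from_nat (fst (prod_decode n)) = a"
    by (rule exI[of _ "prod_encode (to_nat a, m)"]) (simp add: le_prod_encode_2)
qed

section \<open>The limit model of a saturated chain\<close>

locale saturated_chain =
  fixes G :: "gpc set" and c :: "nat \<Rightarrow> sequent" and t :: "nat \<Rightarrow> lform"
  assumes fin: "finite_sequent (c n)"
    and unprovable: "\<not> G \<turnstile> c n"
    and step: "saturation_step G (t n) (c n) (c (Suc n))"
    and fair: "\<exists>n\<ge>m. t n = l"
begin

definition labels :: "var set" where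
  "labels = (\<Union>n. vars (c n))"

definition access :: "(var \<times> var) set" where
  "access = {(x, y). \<exists>n. Rel x y \<in> control (c n)}"

definition valuation :: "var \<Rightarrow> atom set" where
  "valuation x = {p. \<exists>n. Lab x (Atom p) \<in> antecedent (c n)}"

lemma chain_mono: "m \<le> n \<Longrightarrow> extends (c n) (c m)"
proof (induction n rule: dec_induct)
  case (step n)
  have "extends (c (Suc n)) (c n)"
    using saturated_chain.step[OF saturated_chain_axioms] by (simp add: saturation_step_def)
  with step show ?case
    unfolding extends_def by blast
qed (simp add: extends_def)

lemma control_mono: "m \<le> n \<Longrightarrow> control (c m) \<subseteq> control (c n)"
  and antecedent_mono: "m \<le> n \<Longrightarrow> antecedent (c m) \<subseteq> antecedent (c n)"
  and succedent_mono: "m \<le> n \<Longrightarrow> succedent (c m) \<subseteq> succedent (c n)"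
  using chain_mono unfolding extends_def by blast+

text \<open>Fairness schedules the formula again beyond any stage, and by monotonicity it is still
  present then. The bound \<open>n \<ge> m\<close> lets a treatment be chosen late enough to see
  given relational atoms.\<close>

lemma antecedent_treated:
  assumes "Lab x \<phi> \<in> antecedent (c m)"
  shows "\<exists>n\<ge>m. left_analysed (control (c n)) x \<phi> (c (Suc n))"
proof -
  obtain n where "n \<ge> m" "t n = Lab x \<phi>"
    using fair by blast
  with assms antecedent_mono[of m n] step[of n] show ?thesis
    unfolding saturation_step_def by (intro exI[of _ n]) auto
qed

lemma succedent_treated:
  assumes "Lab x \<phi> \<in> succedent (c m)"
  shows "\<exists>n\<ge>m. right_analysed x \<phi> (c (Suc n))"
proof -
  obtain n where "n \<ge> m" "t n = Lab x \<phi>"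
    using fair by blast
  with assms succedent_mono[of m n] step[of n] show ?thesis
    unfolding saturation_step_def by (intro exI[of _ n]) auto
qed

text \<open>Both memberships would persist to a common later stage, which would then be an initial
  sequent.\<close>

lemma chain_disjoint:
  assumes "l \<in> antecedent (c m)"
  shows "l \<notin> succedent (c n)"
proof
  assume "l \<in> succedent (c n)"
  then have "l \<in> antecedent (c (max m n))" "l \<in> succedent (c (max m n))"
    using assms antecedent_mono[of m "max m n"] succedent_mono[of n "max m n"] by auto
  then show False
    using unprovable_disjoint fin unprovable by blast
qed

text \<open>Different treatments of the same formula may choose different premises. A treatment
  after both \<open>y\<close> and \<open>z\<close> have become successors cannot choose the left
  premise, which would put \<open>y\<close> into an antecedent; so it chooses the right one, which
  covers \<open>z\<close> too.\<close>

lemma NonCont_antecedent: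
  assumes l: "Lab x (\<triangle> \<phi>) \<in> antecedent (c m)"
    and y: "(x, y) \<in> access" "\<forall>n. Lab y \<phi> \<notin> antecedent (c n)"
    and z: "(x, z) \<in> access"
  shows "\<exists>n. Lab z \<phi> \<in> succedent (c n)"
proof -
  obtain i j where ij: "Rel x y \<in> control (c i)" "Rel x z \<in> control (c j)"
    using y(1) z unfolding access_def by blast
  let ?k = "max m (max i j)"
  have "Lab x (\<triangle> \<phi>) \<in> antecedent (c ?k)"
    using l antecedent_mono[of m ?k] by auto
  then obtain n where n: "n \<ge> ?k" "left_analysed (control (c n)) x (\<triangle> \<phi>) (c (Suc n))"
    using antecedent_treated by blast
  have "Rel x y \<in> control (c n)" "Rel x z \<in> control (c n)"
    using ij n(1) control_mono[of i n] control_mono[of j n] by auto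
  with n(2) y(2) have "Lab z \<phi> \<in> succedent (c (Suc n))"
    by (auto simp: subset_iff)
  then show ?thesis
    by blast
qed

lemma access_subset: "access \<subseteq> labels \<times> labels"
  using control_vars unfolding access_def labels_def by blast

text \<open>A path along \<beta> imposes finitely many conditions, each holding from some stage on.
  At a stage where all hold, the path lies in the control, and the next stage contains its
  closure.\<close>

lemma access_word_rel:
  assumes g: "g \<in> G" and \<beta>: "\<beta> \<in> lang (gpc_system g) [Fwd]"
  shows "word_rel labels access \<beta> \<subseteq> access"
proof clarify
  fix a b
  assume "(a, b) \<in> word_rel labels access \<beta>"
  then obtain s where s: "s 0 = a" "s (length \<beta>) = b"
      "\<And>i. i \<le> length \<beta> \<Longrightarrow> s i \<in> labels"
      "\<And>i. i < length \<beta> \<Longrightarrow> (s i, s (Suc i)) \<in> letter_rel access (\<beta> ! i)"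
    unfolding word_rel_def by auto
  let ?Q = "\<lambda>n. {(u, v). Rel u v \<in> control (c n)}"
  \<comment> \<open>The closure is computed over the variables of the stage, so the points must lie
    there. For the empty word this is the only condition, and it yields reflexivity.\<close>
  have "eventually (\<lambda>n. s i \<in> vars (c n)) sequentially" if i: "i \<le> length \<beta>" for i
  proof -
    obtain m where "s i \<in> vars (c m)"
      using s(3)[OF i] unfolding labels_def by blast
    then have "\<forall>n\<ge>m. s i \<in> vars (c n)"
      using vars_mono chain_mono by blast
    then show ?thesis
      unfolding eventually_sequentially by blast
  qed
  moreover have "eventually (\<lambda>n. (s i, s (Suc i)) \<in> letter_rel (?Q n) (\<beta> ! i)) sequentially"
    if i: "i < length \<beta>" for i
  proof -
    obtain m where m: "(s i, s (Suc i)) \<in> letter_rel (?Q m) (\<beta> ! i)"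
      using s(4)[OF i] by (cases "\<beta> ! i") (auto simp: access_def)
    have "letter_rel (?Q m) z \<subseteq> letter_rel (?Q n) z" if "m \<le> n" for n z
      using control_mono[OF that] by (cases z) auto
    with m have "\<forall>n\<ge>m. (s i, s (Suc i)) \<in> letter_rel (?Q n) (\<beta> ! i)"
      by blast
    then show ?thesis
      unfolding eventually_sequentially by blast
  qed
  \<comment> \<open>Finitely many eventual properties hold together eventually.\<close>
  ultimately have "eventually (\<lambda>n. (\<forall>i\<in>{..length \<beta>}. s i \<in> vars (c n)) \<and>
      (\<forall>i\<in>{..<length \<beta>}. (s i, s (Suc i)) \<in> letter_rel (?Q n) (\<beta> ! i))) sequentially"
    by (intro eventually_conj eventually_ball_finite) auto
  then obtain n where "\<forall>i\<le>length \<beta>. s i \<in> vars (c n)"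
      "\<forall>i<length \<beta>. (s i, s (Suc i)) \<in> letter_rel (?Q n) (\<beta> ! i)"
    unfolding eventually_sequentially by blast
  then have "(a, b) \<in> word_rel (vars (c n)) (?Q n) \<beta>"
    using s(1,2) unfolding word_rel_def by auto
  moreover have "gpc_system g \<subseteq> system_of G"
    using g unfolding system_of_def by blast
  then have "\<beta> \<in> lang (system_of G) [Fwd]"
    using \<beta> lang_mono by blast
  ultimately have "Rel a b \<in> control_closure G (vars (c n)) (control (c n))"
    unfolding control_closure_def by blast
  then have "Rel a b \<in> control (c (Suc n))"
    using step[of n] unfolding saturation_step_def by blast
  then show "(a, b) \<in> access"
    unfolding access_def by blast
qed

text \<open>Both halves are proved together because an implication moves its left side across the
  sequent. The stage \<open>m\<close> is generalized since subformulae appear only at later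
  stages.\<close>

lemma truth_lemma:
  "(Lab x \<phi> \<in> antecedent (c m) \<longrightarrow> truth access valuation x \<phi>) \<and>
   (Lab x \<phi> \<in> succedent (c m) \<longrightarrow> \<not> truth access valuation x \<phi>)"
proof (induction \<phi> arbitrary: x m)
  case Bot
  show ?case
    using unprovable_no_Bot[OF fin unprovable] by simp
next
  case (Atom p)
  show ?case
    using chain_disjoint by (auto simp: valuation_def)
next
  case (Imp \<phi> \<psi>)
  show ?case
  proof (intro conjI impI)
    assume "Lab x (\<phi> \<^bold>\<rightarrow> \<psi>) \<in> antecedent (c m)"
    from antecedent_treated[OF this] show "truth access valuation x (\<phi> \<^bold>\<rightarrow> \<psi>)"
      using Imp by auto
  next
    assume "Lab x (\<phi> \<^bold>\<rightarrow> \<psi>) \<in> succedent (c m)"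
    from succedent_treated[OF this] show "\<not> truth access valuation x (\<phi> \<^bold>\<rightarrow> \<psi>)"
      using Imp by auto
  qed
next
  case (NonCont \<phi>)
  show ?case
  proof (intro conjI impI)
    assume l: "Lab x (\<triangle> \<phi>) \<in> antecedent (c m)"
    show "truth access valuation x (\<triangle> \<phi>)"
    \<comment> \<open>Either every successor receives the formula in some antecedent, and it is true
      at all of them; or one successor never does, and \<open>NonCont_antecedent\<close> makes it
      false at all of them.\<close>
    proof (cases "\<forall>y. (x, y) \<in> access \<longrightarrow> (\<exists>n. Lab y \<phi> \<in> antecedent (c n))")
      case True
      then show ?thesis
        using NonCont by auto
    next
      case False
      then show ?thesis
        using NonCont_antecedent[OF l] NonCont by fastforce
    qed
  next
    assume "Lab x (\<triangle> \<phi>) \<in> succedent (c m)"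
    from succedent_treated[OF this] obtain n y z where
      "Rel x y \<in> control (c n)" "Rel x z \<in> control (c n)"
      "Lab y \<phi> \<in> antecedent (c n)" "Lab z \<phi> \<in> succedent (c n)"
      by auto
    \<comment> \<open>The formula holds at \<open>y\<close> and fails at \<open>z\<close>, so
      neither alternative for \<open>\<triangle>\<close> remains.\<close>
    then show "\<not> truth access valuation x (\<triangle> \<phi>)"
      using NonCont unfolding access_def by auto
  qed
qed

text \<open>Each variable is interpreted as itself. Being total with values in
  \<open>labels\<close>, the assignment can be the identity only on \<open>labels\<close>; no other
  variable occurs in \<open>c 0\<close>.\<close>

lemma countermodel:
  assumes "range l \<subseteq> labels" and "\<And>x. x \<in> labels \<Longrightarrow> l x = x"
  shows "\<not> holds_sequent access valuation l (c 0)"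
proof -
  obtain \<Omega> \<Gamma> \<Delta> where c0: "c 0 = (\<Omega> \<stileturn> \<Gamma> \<Rrightarrow> \<Delta>)"
    by (cases "c 0")
  have id: "l x = x" if "x \<in> vars (c 0)" for x
    using assms(2) that unfolding labels_def by blast
  have "holds_ratom access l r" if "r \<in> \<Omega>" for r
  proof (cases r)
    case (Rel x y)
    then have "Rel x y \<in> control (c 0)"
      using that c0 by simp
    then show ?thesis
      using Rel id control_vars unfolding access_def by auto
  qed
  moreover have "holds_lform access valuation l \<gamma>" if "\<gamma> \<in> \<Gamma>" for \<gamma>
  proof (cases \<gamma>)
    case (Lab x \<phi>)
    then have "Lab x \<phi> \<in> antecedent (c 0)"
      using that c0 by simp
    then show ?thesis
      using Lab id antecedent_vars truth_lemma by auto
  qed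
  moreover have "\<not> holds_lform access valuation l \<delta>" if "\<delta> \<in> \<Delta>" for \<delta>
  proof (cases \<delta>)
    case (Lab x \<phi>)
    then have "Lab x \<phi> \<in> succedent (c 0)"
      using that c0 by simp
    then show ?thesis
      using Lab id succedent_vars truth_lemma by auto
  qed
  ultimately show ?thesis
    unfolding c0 by auto
qed

lemma frame:
  assumes "labels \<noteq> {}"
  shows "(labels, access) \<in> gpc_frames G"
  using assms access_subset access_word_rel
  by (auto simp: gpc_frames_def is_frame_def satisfies_gpc_def)

end

section \<open>Transport along an injection, from worlds that are variables to the world type of the
  theorem\<close>

lemma truth_inj_image:
  assumes "inj f"
  shows "truth (map_prod f f ` R) V (f x) \<phi> \<longleftrightarrow> truth R (V \<circ> f) x \<phi>"
proof (induction \<phi> arbitrary: x)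
  case (NonCont \<phi>)
  have succ: "(f x, v) \<in> map_prod f f ` R \<longleftrightarrow> (\<exists>y. v = f y \<and> (x, y) \<in> R)" for v
    using inj_eq[OF assms] by (auto simp: image_iff Bex_def)
  show ?case
    by (auto simp: succ NonCont)
qed auto

lemma holds_sequent_inj_image:
  assumes "inj f"
  shows "holds_sequent (map_prod f f ` R) V (f \<circ> l) \<sigma> \<longleftrightarrow> holds_sequent R (V \<circ> f) l \<sigma>"
proof -
  have "holds_ratom (map_prod f f ` R) (f \<circ> l) r \<longleftrightarrow> holds_ratom R l r" for r
    using inj_eq[OF assms] by (cases r) (auto simp: image_iff Bex_def)
  moreover have "holds_lform (map_prod f f ` R) V (f \<circ> l) \<gamma> \<longleftrightarrow> holds_lform R (V \<circ> f) l \<gamma>" for \<gamma>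
    by (cases \<gamma>) (simp add: truth_inj_image[OF assms])
  ultimately show ?thesis
    by (cases \<sigma>) simp
qed

lemma word_rel_inj_image:
  assumes "inj f"
  shows "word_rel (f ` X) (map_prod f f ` R) \<beta> \<subseteq> map_prod f f ` word_rel X R \<beta>"
proof clarify
  fix a b
  assume "(a, b) \<in> word_rel (f ` X) (map_prod f f ` R) \<beta>"
  then obtain s where s: "s 0 = a" "s (length \<beta>) = b"
      "\<And>i. i \<le> length \<beta> \<Longrightarrow> s i \<in> f ` X"
      "\<And>i. i < length \<beta> \<Longrightarrow> (s i, s (Suc i)) \<in> letter_rel (map_prod f f ` R) (\<beta> ! i)"
    unfolding word_rel_def by auto
  \<comment> \<open>Every point of the path lies in the image of \<open>f\<close>, so the path can
    be pulled back pointwise.\<close>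
  let ?s = "inv f \<circ> s"
  have "?s i \<in> X" if "i \<le> length \<beta>" for i
    using s(3)[OF that] assms by auto
  moreover have "(?s i, ?s (Suc i)) \<in> letter_rel R (\<beta> ! i)" if "i < length \<beta>" for i
    using s(4)[OF that] assms by (cases "\<beta> ! i") auto
  ultimately have "(?s 0, ?s (length \<beta>)) \<in> word_rel X R \<beta>"
    unfolding word_rel_def by blast
  moreover have "(a, b) = map_prod f f (?s 0, ?s (length \<beta>))"
    using s(1,2) s(3)[of 0] s(3)[of "length \<beta>"] assms by auto
  ultimately show "(a, b) \<in> map_prod f f ` word_rel X R \<beta>"
    by (rule rev_image_eqI)
qed

lemma gpc_frames_inj_image:
  assumes "inj f" and "(W, R) \<in> gpc_frames G"
  shows "(f ` W, map_prod f f ` R) \<in> gpc_frames G"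
proof -
  have R: "W \<noteq> {}" "R \<subseteq> W \<times> W"
    and gpc: "\<And>g \<beta>. \<lbrakk>g \<in> G; \<beta> \<in> lang (gpc_system g) [Fwd]\<rbrakk> \<Longrightarrow> word_rel W R \<beta> \<subseteq> R"
    using assms(2) by (auto simp: gpc_frames_def is_frame_def satisfies_gpc_def)
  have "word_rel (f ` W) (map_prod f f ` R) \<beta> \<subseteq> map_prod f f ` R"
    if "g \<in> G" "\<beta> \<in> lang (gpc_system g) [Fwd]" for g \<beta>
    using word_rel_inj_image[OF assms(1)] image_mono[OF gpc[OF that]] by (rule order_trans)
  moreover have "map_prod f f ` R \<subseteq> f ` W \<times> f ` W"
    using R(2) by auto
  ultimately show ?thesis
    using R(1) by (simp add: gpc_frames_def is_frame_def satisfies_gpc_def)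
qed

text \<open>Every path relation over a single point is contained in the full relation, which is the
  accessibility here.\<close>

lemma one_point_gpc_frame: "({a}, {(a, a)}) \<in> gpc_frames G"
  using word_rel_subset[of "{a}"] by (fastforce simp: gpc_frames_def is_frame_def satisfies_gpc_def)

section \<open>Completeness\<close>

theorem mainTheorem2:
  fixes G :: "gpc set" and \<sigma> :: sequent
  assumes "infinite (UNIV :: 'w set)"
    and "finite G"
    and "finite_sequent \<sigma>"
    and "valid_over (gpc_frames G :: 'w frame set) \<sigma>"
  shows "G \<turnstile> \<sigma>"
proof (rule ccontr)
  assume unprov: "\<not> G \<turnstile> \<sigma>"
  have valid: "holds_sequent R V l \<sigma>"
    if "(W, R) \<in> gpc_frames G" "range l \<subseteq> W" for W :: "'w set" and R V l
    using assms(4) that unfolding valid_over_def by blast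
  show False
  proof (cases "vars \<sigma> = {}")
    case True
    \<comment> \<open>The chain built below might then have no variables, and a frame is nonempty.\<close>
    obtain \<Omega> \<Gamma> \<Delta> where \<sigma>: "\<sigma> = (\<Omega> \<stileturn> \<Gamma> \<Rrightarrow> \<Delta>)"
      by (cases \<sigma>)
    have "\<Omega> = {}" "\<Gamma> = {}" "\<Delta> = {}"
      using True unfolding \<sigma>
      by (auto split: ratom.splits lform.splits) (metis ratom.exhaust lform.exhaust)+
    \<comment> \<open>The empty sequent has true hypotheses and no succedent to satisfy, so it fails
      in every model; the single world here is \<open>undefined\<close>, the constant value of the
      assignment.\<close>
    then show False
      using valid[OF one_point_gpc_frame, of "\<lambda>_. undefined" undefined] unfolding \<sigma> by auto
  next
    case False
    obtain t :: "nat \<Rightarrow> lform" where t: "\<forall>l m. \<exists>n\<ge>m. t n = l"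
      using fair_enumeration by blast
    obtain c where c: "c 0 = \<sigma>" "\<forall>n. finite_sequent (c n) \<and> \<not> G \<turnstile> c n \<and>
        saturation_step G (t n) (c n) (c (Suc n))"
      using saturated_chain_exists[OF assms(3) unprov] by blast
    interpret saturated_chain G c t
      using t c(2) by unfold_locales auto
    obtain x0 where x0: "x0 \<in> labels"
      using False c(1) unfolding labels_def by fastforce
    \<comment> \<open>The value \<open>x0\<close> for variables outside the chain only keeps the
      range inside the carrier.\<close>
    define l where "l x = (if x \<in> labels then x else x0)" for x
    obtain f :: "nat \<Rightarrow> 'w" where f: "inj f"
      using infinite_countable_subset[OF assms(1)] by blast
    have l: "range l \<subseteq> labels" "\<And>x. x \<in> labels \<Longrightarrow> l x = x"
      using x0 by (auto simp: l_def)
    have "(f ` labels, map_prod f f ` access) \<in> gpc_frames G"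
      using gpc_frames_inj_image[OF f frame] x0 by blast
    moreover have "range (f \<circ> l) \<subseteq> f ` labels"
      using l(1) by auto
    \<comment> \<open>The valuation is pulled back by \<open>inv f\<close>, so that composing it
      with \<open>f\<close> returns \<open>valuation\<close>.\<close>
    ultimately have "holds_sequent (map_prod f f ` access) (valuation \<circ> inv f) (f \<circ> l) \<sigma>"
      by (rule valid)
    then have "holds_sequent access valuation l \<sigma>"
      using f by (simp add: holds_sequent_inj_image comp_assoc)
    then show False
      using countermodel[OF l] c(1) by simp
  qed
qed

end
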